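(* For every integer $t \ge 0$ and every set $X$ with $|X| \in \{3,4\}$, $3^t \le f'(t;X) \le 3^{t+1}$.
   Context: For $p,q \in X^n$, $\mathrm{dist}(p,q)$ is the Hamming distance (number of coordinates in which they differ). $f'(t;X)$ is the maximum $m$ such that there exist an integer $n > t$ and $a_1,\dots,a_m,b_1,\dots,b_m \in X^n$ with $\mathrm{dist}(a_i,b_i) \ge t+1$ for all $i \in [m]$ and $\mathrm{dist}(a_i,b_j)+\mathrm{dist}(a_j,b_i) \le 2t$ for all distinct $i,j \in [m]$. *)

theory Defs
  imports "HOL-Library.FuncSet" "HOL-Library.Extended_Nat"
begin

definition hamming_dist :: "nat \<Rightarrow> (nat \<Rightarrow> 'a) \<Rightarrow> (nat \<Rightarrow> 'a) \<Rightarrow> nat" where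
  "hamming_dist n p q = card {i \<in> {1..n}. p i \<noteq> q i}"

(* X^n is rendered as {1..n} \<rightarrow>\<^sub>E X, i.e. functions on the index set {1..n}. *)
definition admissible :: "nat \<Rightarrow> 'a set \<Rightarrow> nat \<Rightarrow> bool" where
  "admissible t X m \<longleftrightarrow>
     (\<exists>n>t. \<exists>a b :: nat \<Rightarrow> nat \<Rightarrow> 'a.
        (\<forall>i\<in>{1..m}. a i \<in> {1..n} \<rightarrow>\<^sub>E X) \<and>
        (\<forall>i\<in>{1..m}. b i \<in> {1..n} \<rightarrow>\<^sub>E X) \<and>
        (\<forall>i\<in>{1..m}. hamming_dist n (a i) (b i) \<ge> t + 1) \<and>
        (\<forall>i\<in>{1..m}. \<forall>j\<in>{1..m}. i \<noteq> j \<longrightarrow>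
           hamming_dist n (a i) (b j) + hamming_dist n (a j) (b i) \<le> 2 * t))"

(* The supremum is taken in enat, so an unbounded set of admissible m gives \<infinity>;
   a finite value is a maximum, since m = 0 is always admissible and a nonempty
   bounded set of naturals contains its supremum. *)
definition f' :: "nat \<Rightarrow> 'a set \<Rightarrow> enat" where
  "f' t X = (SUP m \<in> {m. admissible t X m}. enat m)"

end

(* Upper bound: for each coordinate k pick a uniformly random 2-subset Z_k of X, and let g_i be the
   sum over k of [b_i(k) \<in> Z_k] - [a_i(k) \<in> Z_k].  Since [y \<in> Z] - [x \<in> Z] \<le> [x \<noteq> y], one has
   g_i + g_j \<le> dist(a_i,b_j) + dist(a_j,b_i) \<le> 2t, so the events g_i \<ge> t+1 are disjoint.  For |X| = 3
   or 4, each coordinate where a_i and b_i differ contributes -1, 0, 1 with probability 1/3 each, so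
   the unimodality of the trinomial coefficients gives each event probability at least 3^-(t+1).

   Lower bound: let a run through the words in (Z/3)^(t+1) whose last letter is the sum of the
   others, and put b = a + 1.  Two such words differ in at least two coordinates, and each of these
   contributes at most 1 to the sum of the two distances. *)
theory Submission
  imports Defs
begin

section \<open>Tails of trinomial coefficients\<close>

text \<open>This counts the sequences in {-1, 0, 1}^d with sum at least \<open>s\<close>; the
  recursion splits off one entry. The threshold is an integer because it can move below 0.\<close>

fun trinomial_tail :: "nat \<Rightarrow> int \<Rightarrow> int" where
  "trinomial_tail 0 s = of_bool (s \<le> 0)"
| "trinomial_tail (Suc d) s =
     trinomial_tail d (s - 1) + trinomial_tail d s + trinomial_tail d (s + 1)"

lemma trinomial_tail_nonneg: "0 \<le> trinomial_tail d s"
  by (induction d arbitrary: s) auto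

lemma trinomial_tail_diag: "1 \<le> trinomial_tail d (int d)"
proof (induction d)
  case (Suc d)
  then show ?case
    using trinomial_tail_nonneg[of d "int d + 1"] trinomial_tail_nonneg[of d "int d + 2"]
    by (simp add: algebra_simps)
qed simp

text \<open>Regrouped as a difference of differences, this is the number of sequences with sum
  exactly \<open>s - 1\<close> minus the number with sum exactly \<open>s\<close>. It also equals
  \<open>trinomial_tail (Suc d) s - 3 * trinomial_tail d s\<close>.\<close>

definition tail_diff2 :: "nat \<Rightarrow> int \<Rightarrow> int" where
  "tail_diff2 d s =
     trinomial_tail d (s - 1) - 2 * trinomial_tail d s + trinomial_tail d (s + 1)"

lemma tail_diff2_Suc:
  "tail_diff2 (Suc d) s = tail_diff2 d (s - 1) + tail_diff2 d s + tail_diff2 d (s + 1)"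
  by (simp add: tail_diff2_def algebra_simps)

text \<open>Negating all entries shows that as many sequences have sum v as have sum -v; this is
  that symmetry for consecutive differences.\<close>

lemma tail_diff2_antisym: "tail_diff2 d (1 - s) = - tail_diff2 d s"
proof (induction d arbitrary: s)
  case 0
  then show ?case by (auto simp: tail_diff2_def)
next
  case (Suc d)
  have "1 - s - 1 = 1 - (s + 1)" "1 - s + 1 = 1 - (s - 1)" by simp_all
  then show ?case by (simp only: tail_diff2_Suc Suc)
qed

text \<open>This is unimodality: trinomial coefficients do not increase when moving away from the
  centre.\<close>

lemma tail_diff2_nonneg: "1 \<le> s \<Longrightarrow> 0 \<le> tail_diff2 d s"
proof (induction d arbitrary: s)
  case 0
  then show ?case by (auto simp: tail_diff2_def)
next
  case (Suc d)
  show ?case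
  proof (cases "s = 1")
    case True
    \<comment> \<open>The recursion reaches down to 0, where the induction hypothesis is silent; by
      antisymmetry the terms at 0 and 1 cancel, leaving the term at 2.\<close>
    then show ?thesis
      using Suc.IH[of 2] tail_diff2_antisym[of d 1] by (simp add: tail_diff2_Suc)
  next
    case False
    then show ?thesis
      using Suc.IH[of "s - 1"] Suc.IH[of s] Suc.IH[of "s + 1"] Suc.prems
      by (simp add: tail_diff2_Suc)
  qed
qed

text \<open>The proportion of sequences of length d with sum at least s does not decrease with d, by
  unimodality, and at d = s the all-ones sequence already gives 3^-s.\<close>

lemma trinomial_tail_lower_bound:
  assumes "1 \<le> s" "s \<le> d"
  shows "3 ^ d \<le> 3 ^ s * trinomial_tail d (int s)"
  using assms(2)
proof (induction d rule: dec_induct)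
  case base
  then show ?case using trinomial_tail_diag[of s] by simp
next
  case (step d)
  have "3 * trinomial_tail d (int s) \<le> trinomial_tail (Suc d) (int s)"
    using tail_diff2_nonneg[of "int s" d] assms(1) by (simp add: tail_diff2_def)
  then have "3 ^ s * (3 * trinomial_tail d (int s)) \<le> 3 ^ s * trinomial_tail (Suc d) (int s)"
    by (intro mult_left_mono) auto
  then show ?case using step.IH unfolding power_Suc by linarith
qed

section \<open>The upper bound\<close>

lemma card_PiE_insert_tail:
  fixes \<sigma> :: "'k \<Rightarrow> 'b \<Rightarrow> int"
  assumes "finite I" "k \<notin> I" "finite F"
  shows "card {Z \<in> insert k I \<rightarrow>\<^sub>E F. s \<le> (\<Sum>l\<in>insert k I. \<sigma> l (Z l))} =
         (\<Sum>z\<in>F. card {Z \<in> I \<rightarrow>\<^sub>E F. s - \<sigma> k z \<le> (\<Sum>l\<in>I. \<sigma> l (Z l))})"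
proof -
  let ?B = "\<lambda>z. {Z \<in> I \<rightarrow>\<^sub>E F. s - \<sigma> k z \<le> (\<Sum>l\<in>I. \<sigma> l (Z l))}"
  let ?h = "\<lambda>(z, Z). Z(k := z)"
  have sum_upd: "(\<Sum>l\<in>insert k I. \<sigma> l ((Z(k := z)) l)) = \<sigma> k z + (\<Sum>l\<in>I. \<sigma> l (Z l))" for z Z
  proof -
    have "(\<Sum>l\<in>I. \<sigma> l ((Z(k := z)) l)) = (\<Sum>l\<in>I. \<sigma> l (Z l))"
      using assms(2) by (intro sum.cong) auto
    then show ?thesis using assms(1,2) by simp
  qed
  have "{Z \<in> insert k I \<rightarrow>\<^sub>E F. s \<le> (\<Sum>l\<in>insert k I. \<sigma> l (Z l))} = ?h ` Sigma F ?B"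
    unfolding PiE_insert_eq
    by (auto simp: sum_upd image_iff simp del: fun_upd_apply)
  moreover have "inj_on ?h (Sigma F ?B)"
    by (rule inj_on_subset[OF inj_combinator[OF assms(2), of "\<lambda>_. F"]]) auto
  moreover have "finite (?B z)" for z
    using assms(1,3) by (simp add: finite_PiE)
  ultimately show ?thesis
    using assms(3) by (simp add: card_image card_SigmaI)
qed

text \<open>For independent uniform choices from \<open>F\<close>, each coordinate in
  \<open>D\<close> contributes -1, 0 or 1 with probability 1/3 each and the others contribute 0, so
  the sum is distributed as that of a uniform sequence in {-1, 0, 1}^d with d =
  \<open>card (I \<inter> D)\<close>. Denominators are cleared.\<close>

lemma card_PiE_tail_eq_trinomial_tail:
  fixes \<sigma> :: "'k \<Rightarrow> 'b \<Rightarrow> int"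
  assumes "finite I" "finite F" "card F = 3 * K"
    and zero: "\<And>k z. k \<in> I - D \<Longrightarrow> z \<in> F \<Longrightarrow> \<sigma> k z = 0"
    and step: "\<And>k z. k \<in> I \<inter> D \<Longrightarrow> z \<in> F \<Longrightarrow> \<sigma> k z \<in> {-1, 0, 1}"
    and plus: "\<And>k. k \<in> I \<inter> D \<Longrightarrow> card {z \<in> F. \<sigma> k z = 1} = K"
    and minus: "\<And>k. k \<in> I \<inter> D \<Longrightarrow> card {z \<in> F. \<sigma> k z = -1} = K"
  shows "3 ^ card (I \<inter> D) * int (card {Z \<in> I \<rightarrow>\<^sub>E F. s \<le> (\<Sum>k\<in>I. \<sigma> k (Z k))}) =
         int (card F) ^ card I * trinomial_tail (card (I \<inter> D)) s"
  using assms(1) zero step plus minus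
proof (induction I arbitrary: s rule: finite_induct)
  case empty
  then show ?case by (auto simp: Collect_conv_if)
next
  case (insert k I)
  define G where "G s = int (card {Z \<in> I \<rightarrow>\<^sub>E F. s \<le> (\<Sum>l\<in>I. \<sigma> l (Z l))})" for s
  have IH: "3 ^ card (I \<inter> D) * G s = int (card F) ^ card I * trinomial_tail (card (I \<inter> D)) s" for s
    unfolding G_def using insert.prems by (intro insert.IH) auto
  have rec: "int (card {Z \<in> insert k I \<rightarrow>\<^sub>E F. s \<le> (\<Sum>l\<in>insert k I. \<sigma> l (Z l))}) =
             (\<Sum>z\<in>F. G (s - \<sigma> k z))"
    by (simp only: card_PiE_insert_tail[OF insert.hyps(1,2) assms(2)] G_def of_nat_sum)
  show ?case
  proof (cases "k \<in> D")
    case False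
    then have "(\<Sum>z\<in>F. G (s - \<sigma> k z)) = int (card F) * G s"
      using insert.prems(1)[of k] by simp
    moreover have "insert k I \<inter> D = I \<inter> D" using False by auto
    ultimately show ?thesis
      unfolding rec using IH[of s] insert.hyps by (simp add: algebra_simps)
  next
    case True
    define A where "A v = {z \<in> F. \<sigma> k z = v}" for v
    have fin: "finite (A v)" for v using assms(2) by (simp add: A_def)
    have F_eq: "F = A (-1) \<union> A 0 \<union> A 1" and disj: "v \<noteq> w \<Longrightarrow> A v \<inter> A w = {}" for v w
      using insert.prems(2)[of k] True by (auto simp: A_def)
    have split: "(\<Sum>z\<in>F. h z) = (\<Sum>z\<in>A (-1). h z) + (\<Sum>z\<in>A 0. h z) + (\<Sum>z\<in>A 1. h z)"
      for h :: "'b \<Rightarrow> int"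
      unfolding F_eq using fin disj
      by (subst sum.union_disjoint, auto simp: Int_Un_distrib2 sum.union_disjoint)+
    have ends: "card (A 1) = K" "card (A (-1)) = K"
      using insert.prems(3,4)[of k] True by (auto simp: A_def)
    \<comment> \<open>Summing the constant 1 counts \<open>F\<close>: the middle class gets 3K -
      2K.\<close>
    then have mid: "card (A 0) = K"
      using split[of "\<lambda>_. 1"] assms(3) by simp
    have "(\<Sum>z\<in>A v. G (s - \<sigma> k z)) = int (card (A v)) * G (s - v)" for v
      by (simp add: A_def)
    then have "(\<Sum>z\<in>F. G (s - \<sigma> k z)) = int K * (G (s - 1) + G s + G (s + 1))"
      by (simp add: split ends mid algebra_simps)
    moreover have "card (insert k I \<inter> D) = Suc (card (I \<inter> D))"
      using True insert.hyps by simp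
    ultimately have "3 ^ card (insert k I \<inter> D) * (\<Sum>z\<in>F. G (s - \<sigma> k z)) =
        3 * int K * (3 ^ card (I \<inter> D) * G (s - 1) + 3 ^ card (I \<inter> D) * G s
                     + 3 ^ card (I \<inter> D) * G (s + 1))"
      by (simp add: algebra_simps)
    also have "\<dots> = int (card F) ^ card (insert k I) * trinomial_tail (card (insert k I \<inter> D)) s"
      using True insert.hyps assms(3) by (simp only: IH) (simp add: algebra_simps)
    finally show ?thesis unfolding rec .
  qed
qed

text \<open>The partner of y in Z can be any element of X other than x and y.\<close>

lemma card_2_subsets_separating:
  assumes "finite X" "x \<in> X" "y \<in> X" "x \<noteq> y"
  shows "card {Z. Z \<subseteq> X \<and> card Z = 2 \<and> y \<in> Z \<and> x \<notin> Z} = card X - 2"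
proof -
  have "{Z. Z \<subseteq> X \<and> card Z = 2 \<and> y \<in> Z \<and> x \<notin> Z} = (\<lambda>u. {y, u}) ` (X - {x, y})"
  proof (intro set_eqI iffI)
    fix Z assume Z: "Z \<in> {Z. Z \<subseteq> X \<and> card Z = 2 \<and> y \<in> Z \<and> x \<notin> Z}"
    then obtain u where "Z = {y, u}" "u \<noteq> y"
      unfolding card_2_iff by blast
    with Z show "Z \<in> (\<lambda>u. {y, u}) ` (X - {x, y})" by blast
  next
    fix Z assume "Z \<in> (\<lambda>u. {y, u}) ` (X - {x, y})"
    with assms show "Z \<in> {Z. Z \<subseteq> X \<and> card Z = 2 \<and> y \<in> Z \<and> x \<notin> Z}" by auto
  qed
  moreover have "inj_on (\<lambda>u. {y, u}) (X - {x, y})"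
    by (auto simp: inj_on_def doubleton_eq_iff)
  ultimately show ?thesis
    using assms by (simp add: card_image card_Diff_subset)
qed

lemma hamming_dist_eq_sum: "int (hamming_dist n p q) = (\<Sum>k\<in>{1..n}. of_bool (p k \<noteq> q k))"
  by (simp add: hamming_dist_def Int_def)

lemma admissible_le:
  assumes X: "card X \<in> {3, 4}" and "admissible t X m"
  shows "m \<le> 3 ^ (t + 1)"
proof -
  from assms(2) obtain n and a b :: "nat \<Rightarrow> nat \<Rightarrow> 'a" where
    "\<forall>i\<in>{1..m}. a i \<in> {1..n} \<rightarrow>\<^sub>E X"
    "\<forall>i\<in>{1..m}. b i \<in> {1..n} \<rightarrow>\<^sub>E X"
    "\<forall>i\<in>{1..m}. t + 1 \<le> hamming_dist n (a i) (b i)"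
    "\<forall>i\<in>{1..m}. \<forall>j\<in>{1..m}. i \<noteq> j \<longrightarrow>
       hamming_dist n (a i) (b j) + hamming_dist n (a j) (b i) \<le> 2 * t"
    unfolding admissible_def by (elim exE conjE) (rule that; assumption)
  note a = this(1)[rule_format] and b = this(2)[rule_format]
    and far = this(3)[rule_format] and near = this(4)[rule_format]
  have finX: "finite X" using X by (auto intro: card_ge_0_finite)
  define F where "F = {Z. Z \<subseteq> X \<and> card Z = 2}"
  have finF: "finite F" unfolding F_def using finX by simp
  \<comment> \<open>With q = |X|, the equation q(q-1)/2 = 3(q-2) reads (q-3)(q-4) = 0. It makes a
    random pair contain one given letter and avoid another with probability exactly 1/3.\<close>
  have cardF: "card F = 3 * (card X - 2)"
    using X n_subsets[OF finX, of 2] by (auto simp: F_def choose_two)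
  define \<sigma> :: "nat \<Rightarrow> nat \<Rightarrow> 'a set \<Rightarrow> int" where
    "\<sigma> i k Z = of_bool (b i k \<in> Z) - of_bool (a i k \<in> Z)" for i k Z
  define E where
    "E i = {Z \<in> {1..n} \<rightarrow>\<^sub>E F. int (t + 1) \<le> (\<Sum>k\<in>{1..n}. \<sigma> i k (Z k))}" for i
  have finP: "finite ({1..n} \<rightarrow>\<^sub>E F)" using finF by (simp add: finite_PiE)
  have E_lower: "card F ^ n \<le> 3 ^ (t + 1) * card (E i)" if i: "i \<in> {1..m}" for i
  proof -
    define D where "D = {k. a i k \<noteq> b i k}"
    have d: "card ({1..n} \<inter> D) = hamming_dist n (a i) (b i)"
      by (simp add: hamming_dist_def D_def Int_def)
    let ?d = "hamming_dist n (a i) (b i)"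
    \<comment> \<open>Where \<open>a i\<close> and \<open>b i\<close> differ, the values 1 and -1 of
      \<open>\<sigma>\<close> are each taken by \<open>card X - 2\<close> pairs; elsewhere its two
      indicators cancel.\<close>
    have count: "3 ^ ?d * int (card (E i)) = int (card F) ^ n * trinomial_tail ?d (int (t + 1))"
    proof -
      have sep: "card {Z \<in> F. \<sigma> i k Z = 1} = card X - 2" "card {Z \<in> F. \<sigma> i k Z = -1} = card X - 2"
        if k: "k \<in> {1..n} \<inter> D" for k
      proof -
        have in_X: "a i k \<in> X" "b i k \<in> X" using a[OF i] b[OF i] k by auto
        have "{Z \<in> F. \<sigma> i k Z = 1} = {Z. Z \<subseteq> X \<and> card Z = 2 \<and> b i k \<in> Z \<and> a i k \<notin> Z}"
          "{Z \<in> F. \<sigma> i k Z = -1} = {Z. Z \<subseteq> X \<and> card Z = 2 \<and> a i k \<in> Z \<and> b i k \<notin> Z}"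
          by (auto simp: F_def \<sigma>_def of_bool_def split: if_splits)
        then show "card {Z \<in> F. \<sigma> i k Z = 1} = card X - 2"
          "card {Z \<in> F. \<sigma> i k Z = -1} = card X - 2"
          using card_2_subsets_separating[OF finX] in_X k by (auto simp: D_def)
      qed
      show ?thesis
        using card_PiE_tail_eq_trinomial_tail[of "{1..n}" F "card X - 2" D "\<sigma> i" "int (t + 1)"]
          finF cardF sep
        unfolding d E_def by (auto simp: \<sigma>_def D_def)
    qed
    have "3 ^ ?d * int (card F ^ n) \<le>
        (3 ^ (t + 1) * trinomial_tail ?d (int (t + 1))) * int (card F ^ n)"
      using trinomial_tail_lower_bound[of "t + 1" ?d] far[OF i] by (intro mult_right_mono) auto
    also have "\<dots> = 3 ^ ?d * int (3 ^ (t + 1) * card (E i))"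
      using count by (simp add: algebra_simps)
    finally have "int (card F ^ n) \<le> int (3 ^ (t + 1) * card (E i))"
      by (rule mult_left_le_imp_le) simp
    then show ?thesis by (simp only: of_nat_le_iff)
  qed
  have E_disj: "E i \<inter> E j = {}" if ij: "i \<in> {1..m}" "j \<in> {1..m}" "i \<noteq> j" for i j
  proof (rule ccontr)
    assume "E i \<inter> E j \<noteq> {}"
    then obtain Z where "int (t + 1) \<le> (\<Sum>k\<in>{1..n}. \<sigma> i k (Z k))"
      "int (t + 1) \<le> (\<Sum>k\<in>{1..n}. \<sigma> j k (Z k))"
      by (auto simp: E_def)
    then have "2 * int t + 2 \<le> (\<Sum>k\<in>{1..n}. \<sigma> i k (Z k) + \<sigma> j k (Z k))"
      by (simp add: sum.distrib)
    \<comment> \<open>The four indicators are regrouped crosswise, \<open>b j\<close> with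
      \<open>a i\<close> and \<open>b i\<close> with \<open>a j\<close>; each difference is positive
      only if its two letters differ.\<close>
    also have "\<dots> \<le> (\<Sum>k\<in>{1..n}. of_bool (a i k \<noteq> b j k) + of_bool (a j k \<noteq> b i k))"
      by (intro sum_mono) (auto simp: \<sigma>_def of_bool_def)
    also have "\<dots> = int (hamming_dist n (a i) (b j) + hamming_dist n (a j) (b i))"
      by (simp only: sum.distrib of_nat_add hamming_dist_eq_sum)
    also have "\<dots> \<le> 2 * int t" using near[OF ij] by linarith
    finally show False by simp
  qed
  have "m * card F ^ n = (\<Sum>i\<in>{1..m}. card F ^ n)" by simp
  also have "\<dots> \<le> (\<Sum>i\<in>{1..m}. 3 ^ (t + 1) * card (E i))"
    by (intro sum_mono E_lower)
  also have "\<dots> = 3 ^ (t + 1) * card (\<Union>i\<in>{1..m}. E i)"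
    using E_disj finP by (subst card_UN_disjoint) (auto simp: sum_distrib_left E_def)
  also have "card (\<Union>i\<in>{1..m}. E i) \<le> card ({1..n} \<rightarrow>\<^sub>E F)"
    using finP by (intro card_mono) (auto simp: E_def)
  also have "card ({1..n} \<rightarrow>\<^sub>E F) = card F ^ n" by (simp add: card_PiE)
  \<comment> \<open>The factor \<open>card F ^ n\<close> cancels, since \<open>card F\<close> is 3
    or 6.\<close>
  finally show ?thesis using X cardF by auto
qed

section \<open>The lower bound\<close>

text \<open>If k were the only position of disagreement, equal check digits and equal remaining
  letters would force the letters at k to agree mod 3, hence to be equal.\<close>

lemma two_le_hamming_dist_check_digit:
  fixes c c' :: "nat \<Rightarrow> nat"
  assumes "\<And>k. k \<in> {1..t} \<Longrightarrow> c k < 3 \<and> c' k < 3"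
    and c: "c (Suc t) = (\<Sum>k\<in>{1..t}. c k) mod 3" and c': "c' (Suc t) = (\<Sum>k\<in>{1..t}. c' k) mod 3"
    and k: "k \<in> {1..t}" "c k \<noteq> c' k"
  shows "2 \<le> hamming_dist (Suc t) c c'"
proof -
  have "\<exists>l \<in> {1..Suc t}. l \<noteq> k \<and> c l \<noteq> c' l"
  proof (rule ccontr)
    assume "\<not> ?thesis"
    then have same: "c l = c' l" if "l \<in> {1..Suc t}" "l \<noteq> k" for l using that by blast
    have "(\<Sum>l\<in>{1..t} - {k}. c l) = (\<Sum>l\<in>{1..t} - {k}. c' l)"
      using same by (intro sum.cong) auto
    moreover have "(\<Sum>l\<in>{1..t}. c l) mod 3 = (\<Sum>l\<in>{1..t}. c' l) mod 3"
      using same[of "Suc t"] c c' k by simp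
    ultimately have "(c k + (\<Sum>l\<in>{1..t} - {k}. c l)) mod 3 =
        (c' k + (\<Sum>l\<in>{1..t} - {k}. c l)) mod 3"
      using k by (simp add: sum.remove)
    then have "c k mod 3 = c' k mod 3" by presburger
    then show False using assms(1)[OF k(1)] k(2) by simp
  qed
  then obtain l where l: "l \<in> {1..Suc t}" "l \<noteq> k" "c l \<noteq> c' l" by blast
  have "card {k, l} \<le> card {k \<in> {1..Suc t}. c k \<noteq> c' k}"
    using l k by (intro card_mono) auto
  then show ?thesis using l by (simp add: hamming_dist_def)
qed

lemma admissible_power_3:
  assumes X: "card X \<in> {3, 4}"
  shows "admissible t X (3 ^ t)"
proof -
  have "finite X" using X by (auto intro: card_ge_0_finite)
  \<comment> \<open>\<open>e\<close> selects three letters of X to play the role of Z/3.\<close>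
  then obtain e :: "nat \<Rightarrow> 'a" where e: "e ` {..<3} \<subseteq> X" "inj_on e {..<3}"
    using card_le_inj[of "{..<3::nat}" X] X by auto
  have "card ({1..t} \<rightarrow>\<^sub>E {..<3::nat}) = 3 ^ t" by (simp add: card_PiE)
  then obtain \<phi> :: "nat \<Rightarrow> nat \<Rightarrow> nat" where \<phi>: "bij_betw \<phi> {1..3 ^ t} ({1..t} \<rightarrow>\<^sub>E {..<3::nat})"
    using ex_bij_betw_nat_finite_1[of "{1..t} \<rightarrow>\<^sub>E {..<3::nat}"] by (auto simp: finite_PiE)
  \<comment> \<open>The \<open>3 ^ t\<close> words \<open>\<phi> i\<close> of length t are extended
    by a check digit at position \<open>Suc t\<close>.\<close>
  define c where "c i k = (if k = Suc t then (\<Sum>l\<in>{1..t}. \<phi> i l) mod 3 else \<phi> i k)" for i k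
  define a where "a i = restrict (\<lambda>k. e (c i k)) {1..Suc t}" for i
  define b where "b i = restrict (\<lambda>k. e (Suc (c i k) mod 3)) {1..Suc t}" for i
  have c_less: "c i k < 3" if "i \<in> {1..3 ^ t}" "k \<in> {1..Suc t}" for i k
    using bij_betwE[OF \<phi>] that by (auto simp: c_def PiE_iff)
  have e_eq: "e x = e y \<longleftrightarrow> x = y" if "x < 3" "y < 3" for x y
    using e(2) that by (auto simp: inj_on_def)
  have a_X: "a i \<in> {1..Suc t} \<rightarrow>\<^sub>E X" and b_X: "b i \<in> {1..Suc t} \<rightarrow>\<^sub>E X" if "i \<in> {1..3 ^ t}" for i
    using e(1) c_less[OF that] by (auto simp: a_def b_def)
  have far: "hamming_dist (Suc t) (a i) (b i) = Suc t" if "i \<in> {1..3 ^ t}" for i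
  proof -
    have "a i k \<noteq> b i k" if k: "k \<in> {1..Suc t}" for k
    proof -
      have "c i k \<noteq> Suc (c i k) mod 3" by presburger
      then show ?thesis using c_less[OF \<open>i \<in> _\<close> k] k by (simp add: a_def b_def e_eq)
    qed
    then have "{k \<in> {1..Suc t}. a i k \<noteq> b i k} = {1..Suc t}" by blast
    then show ?thesis by (simp add: hamming_dist_def)
  qed
  have near: "hamming_dist (Suc t) (a i) (b j) + hamming_dist (Suc t) (a j) (b i) \<le> 2 * t"
    if ij: "i \<in> {1..3 ^ t}" "j \<in> {1..3 ^ t}" "i \<noteq> j" for i j
  proof -
    have "\<phi> i \<noteq> \<phi> j" and PiE: "\<phi> i \<in> {1..t} \<rightarrow>\<^sub>E {..<3}" "\<phi> j \<in> {1..t} \<rightarrow>\<^sub>E {..<3}"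
      using \<phi> ij by (auto simp: bij_betw_def inj_on_def)
    then obtain k where k: "k \<in> {1..t}" "\<phi> i k \<noteq> \<phi> j k"
      using PiE_ext by blast
    have two: "2 \<le> hamming_dist (Suc t) (c i) (c j)"
      by (rule two_le_hamming_dist_check_digit[of t "c i" "c j" k])
        (use PiE k in \<open>auto simp: c_def PiE_iff\<close>)
    \<comment> \<open>Equal letters of \<open>c i\<close> and \<open>c j\<close> cost 2. Distinct
      residues mod 3 differ by 1 or -1, so one is the successor of the other, and one of the two
      mismatches disappears.\<close>
    have *: "of_bool (a i k \<noteq> b j k) + of_bool (a j k \<noteq> b i k) \<le> (2 - of_bool (c i k \<noteq> c j k) :: int)"
      if k: "k \<in> {1..Suc t}" for k
    proof -
      have less: "c i k < 3" "c j k < 3" using c_less ij k by auto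
      then have "c i k = 0 \<or> c i k = 1 \<or> c i k = 2" "c j k = 0 \<or> c j k = 1 \<or> c j k = 2"
        by linarith+
      then have "c i k \<noteq> c j k \<Longrightarrow> c i k = Suc (c j k) mod 3 \<or> c j k = Suc (c i k) mod 3"
        by auto
      then show ?thesis using less k by (auto simp: a_def b_def e_eq)
    qed
    have "int (hamming_dist (Suc t) (a i) (b j) + hamming_dist (Suc t) (a j) (b i)) =
        (\<Sum>k\<in>{1..Suc t}. of_bool (a i k \<noteq> b j k) + of_bool (a j k \<noteq> b i k))"
      by (simp only: sum.distrib of_nat_add hamming_dist_eq_sum)
    also have "\<dots> \<le> (\<Sum>k\<in>{1..Suc t}. 2 - of_bool (c i k \<noteq> c j k))"
      by (intro sum_mono *)
    also have "\<dots> = 2 * int (Suc t) - int (hamming_dist (Suc t) (c i) (c j))"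
      by (simp only: sum_subtractf hamming_dist_eq_sum) simp
    \<comment> \<open>The two guaranteed disagreements bring 2(t+1) down to 2t.\<close>
    also have "\<dots> \<le> int (2 * t)" using two by simp
    finally show ?thesis by (simp only: of_nat_le_iff)
  qed
  show ?thesis
    unfolding admissible_def
    by (intro exI[of _ "Suc t"] exI[of _ a] exI[of _ b] conjI ballI impI)
      (use a_X b_X far near in auto)
qed

theorem theorem3p3:
  fixes t :: nat and X :: "'a set"
  assumes "card X \<in> {3, 4}"
  shows "3 ^ t \<le> f' t X \<and> f' t X \<le> 3 ^ (t + 1)"
proof -
  have enat_power: "(3 :: enat) ^ k = enat (3 ^ k)" for k
    by (induction k) (auto simp: one_enat_def numeral_eq_enat)
  have "enat (3 ^ t) \<le> f' t X"
    unfolding f'_def by (intro SUP_upper) (simp add: admissible_power_3[OF assms])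
  moreover have "f' t X \<le> enat (3 ^ (t + 1))"
    unfolding f'_def using admissible_le[OF assms, of t] by (intro SUP_least) auto
  ultimately show ?thesis by (simp only: enat_power)
qed

end
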